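(* Let $\mathbf{B}$ be a topological Boolean algebra, $\nabla$ an open filter and $\Delta$ a closed ideal of $\mathbf{B}$, and $\mathbf{T}=Tw(\mathbf{B},\nabla,\Delta)$. Suppose that $\mathbf{B}\models\mathsf{Grz}$ and $\mathsf{G}(\mathbf{B})=\Lambda(\mathbf{B},\nabla)$. Then for every formula $\varphi$ of the language $\{\wedge,\vee,\to,\bot,\sim\}$: $$\mathcal{G}_2(\mathbf{T})\models\varphi\iff\mathbf{T}\models\mathrm{T}_{\mathbf{B}}\varphi.$$
   Context: A topological Boolean algebra (TBA) is an algebra $\mathbf{B}=\langle B;\vee,\wedge,\to,\bot,\Box\rangle$ whose reduct is a Boolean algebra (top $1$, $\neg a:=a\to\bot$) with $\Box 1=1$, $\Box(a\wedge b)=\Box a\wedge\Box b$, $\Box a\le a$, $\Box a\le\Box\Box a$; $\Diamond a:=\neg\Box\neg a$. $\mathsf{G}(\mathbf{B})=\{a\in B:\Box a=a\}$; $\mathcal{G}(\mathbf{B})$ is the Heyting algebra on $\mathsf{G}(\mathbf{B})$ with $\vee,\wedge,\bot$ of $\mathbf{B}$ and $a\to_{\mathcal{G}(\mathbf{B})}b:=\Box(a\to b)$. Full twist-structure $\mathbf{C}^{\bowtie}$ over a Heyting algebra or TBA $\mathbf{C}$: universe $C\times C$, $(a,b)\vee(c,d)=(a\vee c,b\wedge d)$, $(a,b)\wedge(c,d)=(a\wedge c,b\vee d)$, $(a,b)\to(c,d)=(a\to c,a\wedge d)$, $\bot=(\bot,1)$, $\sim(a,b)=(b,a)$, and for a TBA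 $\Box(a,b)=(\Box a,\Diamond b)$, $\Diamond(a,b)=(\Diamond a,\Box b)$. A filter is open if closed under $\Box$, an ideal closed if closed under $\Diamond$. $Tw(\mathbf{B},\nabla,\Delta)$ is the subalgebra of $\mathbf{B}^{\bowtie}$ on $\{(a,b):a\vee b\in\nabla,\ a\wedge b\in\Delta\}$. $\Lambda(\mathbf{B},\nabla)=\{a\in\mathsf{G}(\mathbf{B}):a\vee\Box\neg a\in\nabla\}$. $\mathcal{G}_2(\mathbf{T})$ is the algebra on $\mathsf{G}_2(\mathbf{T})=\{(a,b)\in\mathbf{T}:\Box a=a,\Box b=b\}$ with the operations $\vee,\wedge,\to,\bot,\sim$ of $\mathcal{G}(\mathbf{B})^{\bowtie}$ (so $(a,b)\to(c,d)=(\Box(a\to c),a\wedge d)$). $\mathsf{Grz}$ is the least set of formulas in $\wedge,\vee,\to,\bot,\Box$ containing classical tautology axioms, $\Box(p\to p)$, $(\Box p\wedge\Box q)\to\Box(p\wedge q)$, $\Box p\to p$, $\Box p\to\Box\Box p$, $\Box(\Box(p\to\Box p)\to p)\to p$, closed under substitution, modus ponens and from $\varphi\to\psi$ infer $\Box\varphi\to\Box\psi$; $\mathbf{B}\models\mathsf{Grz}$ means every formula of $\mathsf{Grz}$ evaluates to $1$ under every valuation in $\mathbf{B}$. Validity in a twist-structure $\mathcal{A}$: $\mathcal{A}\models\varphi$ iff $\pi_1(v(\varphi))=1$ for every homomorphism $v$ from the formula algebra into $\mathcal{A}$. Translation $\mathrm{T}_{\mathbf{B}}$: $\mathrm{T}_{\mathbf{B}}(p)=\Box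 p$, $\mathrm{T}_{\mathbf{B}}(\sim p)=\Box\sim p$, $\mathrm{T}_{\mathbf{B}}(\bot)=\bot$, $\mathrm{T}_{\mathbf{B}}(\sim\bot)=\sim\bot$, $\mathrm{T}_{\mathbf{B}}(\varphi\wedge\psi)=\mathrm{T}_{\mathbf{B}}\varphi\wedge\mathrm{T}_{\mathbf{B}}\psi$, $\mathrm{T}_{\mathbf{B}}(\varphi\vee\psi)=\mathrm{T}_{\mathbf{B}}\varphi\vee\mathrm{T}_{\mathbf{B}}\psi$, $\mathrm{T}_{\mathbf{B}}(\varphi\to\psi)=\Box(\mathrm{T}_{\mathbf{B}}\varphi\to\mathrm{T}_{\mathbf{B}}\psi)$, $\mathrm{T}_{\mathbf{B}}(\sim(\varphi\wedge\psi))=\mathrm{T}_{\mathbf{B}}(\sim\varphi)\vee\mathrm{T}_{\mathbf{B}}(\sim\psi)$, $\mathrm{T}_{\mathbf{B}}(\sim(\varphi\vee\psi))=\mathrm{T}_{\mathbf{B}}(\sim\varphi)\wedge\mathrm{T}_{\mathbf{B}}(\sim\psi)$, $\mathrm{T}_{\mathbf{B}}(\sim(\varphi\to\psi))=\mathrm{T}_{\mathbf{B}}\varphi\wedge\mathrm{T}_{\mathbf{B}}(\sim\psi)$, $\mathrm{T}_{\mathbf{B}}(\sim\sim\varphi)=\mathrm{T}_{\mathbf{B}}\varphi$. *)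

theory Defs
  imports Main
begin

section \<open>Topological Boolean algebras\<close>

text \<open>The Boolean reduct is the type class; the implication \<open>a \<rightarrow> b\<close> of a Boolean algebra is
  \<open>- a \<squnion> b\<close>, so that \<open>a \<rightarrow> \<bottom> = - a\<close>. One-element algebras are included.\<close>

definition bimp :: "'a::boolean_algebra \<Rightarrow> 'a \<Rightarrow> 'a" where
  "bimp a b = sup (- a) b"

locale tba =
  fixes box :: "'a::boolean_algebra \<Rightarrow> 'a"
  assumes box_top: "box top = top"
    and box_inf: "box (inf a b) = inf (box a) (box b)"
    and box_le: "box a \<le> a"
    and box_le_box_box: "box a \<le> box (box a)"

definition dia :: "('a::boolean_algebra \<Rightarrow> 'a) \<Rightarrow> 'a \<Rightarrow> 'a" where
  "dia box a = - box (- a)"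

text \<open>Filters and ideals are not required to be proper.\<close>

definition lat_filter :: "'a::lattice set \<Rightarrow> bool" where
  "lat_filter F \<longleftrightarrow>
     F \<noteq> {} \<and> (\<forall>a\<in>F. \<forall>b\<in>F. inf a b \<in> F) \<and> (\<forall>a\<in>F. \<forall>b. a \<le> b \<longrightarrow> b \<in> F)"

definition lat_ideal :: "'a::lattice set \<Rightarrow> bool" where
  "lat_ideal I \<longleftrightarrow>
     I \<noteq> {} \<and> (\<forall>a\<in>I. \<forall>b\<in>I. sup a b \<in> I) \<and> (\<forall>a\<in>I. \<forall>b. b \<le> a \<longrightarrow> b \<in> I)"

definition open_filter :: "('a::boolean_algebra \<Rightarrow> 'a) \<Rightarrow> 'a set \<Rightarrow> bool" where
  "open_filter box F \<longleftrightarrow> lat_filter F \<and> (\<forall>a\<in>F. box a \<in> F)"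

definition closed_ideal :: "('a::boolean_algebra \<Rightarrow> 'a) \<Rightarrow> 'a set \<Rightarrow> bool" where
  "closed_ideal box I \<longleftrightarrow> lat_ideal I \<and> (\<forall>a\<in>I. dia box a \<in> I)"

definition open_elems :: "('a::boolean_algebra \<Rightarrow> 'a) \<Rightarrow> 'a set" where
  "open_elems box = {a. box a = a}"

definition open_imp :: "('a::boolean_algebra \<Rightarrow> 'a) \<Rightarrow> 'a \<Rightarrow> 'a \<Rightarrow> 'a" where
  "open_imp box a b = box (bimp a b)"

definition Lam :: "('a::boolean_algebra \<Rightarrow> 'a) \<Rightarrow> 'a set \<Rightarrow> 'a set" where
  "Lam box F = {a \<in> open_elems box. sup a (box (- a)) \<in> F}"


section \<open>Twist-structures\<close>

record 'b alg =
  univ :: "'b set"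
  a_or :: "'b \<Rightarrow> 'b \<Rightarrow> 'b"
  a_and :: "'b \<Rightarrow> 'b \<Rightarrow> 'b"
  a_imp :: "'b \<Rightarrow> 'b \<Rightarrow> 'b"
  a_bot :: "'b"
  a_neg :: "'b \<Rightarrow> 'b"

record 'b modal_alg = "'b alg" +
  a_box :: "'b \<Rightarrow> 'b"
  a_dia :: "'b \<Rightarrow> 'b"

definition tw_or :: "'a::boolean_algebra \<times> 'a \<Rightarrow> 'a \<times> 'a \<Rightarrow> 'a \<times> 'a" where
  "tw_or = (\<lambda>(a, b) (c, d). (sup a c, inf b d))"

definition tw_and :: "'a::boolean_algebra \<times> 'a \<Rightarrow> 'a \<times> 'a \<Rightarrow> 'a \<times> 'a" where
  "tw_and = (\<lambda>(a, b) (c, d). (inf a c, sup b d))"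

definition tw_imp ::
  "('a::boolean_algebra \<Rightarrow> 'a \<Rightarrow> 'a) \<Rightarrow> 'a \<times> 'a \<Rightarrow> 'a \<times> 'a \<Rightarrow> 'a \<times> 'a" where
  "tw_imp imp = (\<lambda>(a, b) (c, d). (imp a c, inf a d))"

definition tw_bot :: "'a::boolean_algebra \<times> 'a" where
  "tw_bot = (bot, top)"

definition tw_neg :: "'a \<times> 'a \<Rightarrow> 'a \<times> 'a" where
  "tw_neg = (\<lambda>(a, b). (b, a))"

definition tw_box :: "('a::boolean_algebra \<Rightarrow> 'a) \<Rightarrow> 'a \<times> 'a \<Rightarrow> 'a \<times> 'a" where
  "tw_box box = (\<lambda>(a, b). (box a, dia box b))"

definition tw_dia :: "('a::boolean_algebra \<Rightarrow> 'a) \<Rightarrow> 'a \<times> 'a \<Rightarrow> 'a \<times> 'a" where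
  "tw_dia box = (\<lambda>(a, b). (dia box a, box b))"

definition tba_twist :: "('a::boolean_algebra \<Rightarrow> 'a) \<Rightarrow> ('a \<times> 'a) modal_alg" where
  "tba_twist box =
     \<lparr>univ = UNIV, a_or = tw_or, a_and = tw_and, a_imp = tw_imp bimp,
      a_bot = tw_bot, a_neg = tw_neg, a_box = tw_box box, a_dia = tw_dia box\<rparr>"

definition open_twist :: "('a::boolean_algebra \<Rightarrow> 'a) \<Rightarrow> ('a \<times> 'a) alg" where
  "open_twist box =
     \<lparr>univ = open_elems box \<times> open_elems box, a_or = tw_or, a_and = tw_and,
      a_imp = tw_imp (open_imp box), a_bot = tw_bot, a_neg = tw_neg\<rparr>"

definition Tw ::
  "('a::boolean_algebra \<Rightarrow> 'a) \<Rightarrow> 'a set \<Rightarrow> 'a set \<Rightarrow> ('a \<times> 'a) modal_alg" where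
  "Tw box F I = (tba_twist box)\<lparr>univ := {(a, b). sup a b \<in> F \<and> inf a b \<in> I}\<rparr>"

text \<open>This set is closed under the implication of \<open>open_twist box\<close> for \<open>T = Tw box F I\<close> when
  \<open>open_elems box = Lam box F\<close>, but not in general.\<close>

definition G2 ::
  "('a::boolean_algebra \<Rightarrow> 'a) \<Rightarrow> ('a \<times> 'a) modal_alg \<Rightarrow> ('a \<times> 'a) alg" where
  "G2 box T = (open_twist box)\<lparr>univ := {(a, b). (a, b) \<in> univ T \<and> box a = a \<and> box b = b}\<rparr>"


section \<open>The logic Grz\<close>

datatype mfm =
    MVar nat
  | MBot
  | MAnd mfm mfm
  | MOr mfm mfm
  | MImp mfm mfm
  | MBox mfm

primrec msubst :: "(nat \<Rightarrow> mfm) \<Rightarrow> mfm \<Rightarrow> mfm" where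
  "msubst s (MVar p) = s p"
| "msubst s MBot = MBot"
| "msubst s (MAnd \<phi> \<psi>) = MAnd (msubst s \<phi>) (msubst s \<psi>)"
| "msubst s (MOr \<phi> \<psi>) = MOr (msubst s \<phi>) (msubst s \<psi>)"
| "msubst s (MImp \<phi> \<psi>) = MImp (msubst s \<phi>) (msubst s \<psi>)"
| "msubst s (MBox \<phi>) = MBox (msubst s \<phi>)"

primrec meval :: "('a::boolean_algebra \<Rightarrow> 'a) \<Rightarrow> (nat \<Rightarrow> 'a) \<Rightarrow> mfm \<Rightarrow> 'a" where
  "meval box v (MVar p) = v p"
| "meval box v MBot = bot"
| "meval box v (MAnd \<phi> \<psi>) = inf (meval box v \<phi>) (meval box v \<psi>)"
| "meval box v (MOr \<phi> \<psi>) = sup (meval box v \<phi>) (meval box v \<psi>)"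
| "meval box v (MImp \<phi> \<psi>) = bimp (meval box v \<phi>) (meval box v \<psi>)"
| "meval box v (MBox \<phi>) = box (meval box v \<phi>)"

primrec box_free :: "mfm \<Rightarrow> bool" where
  "box_free (MVar p) = True"
| "box_free MBot = True"
| "box_free (MAnd \<phi> \<psi>) = (box_free \<phi> \<and> box_free \<psi>)"
| "box_free (MOr \<phi> \<psi>) = (box_free \<phi> \<and> box_free \<psi>)"
| "box_free (MImp \<phi> \<psi>) = (box_free \<phi> \<and> box_free \<psi>)"
| "box_free (MBox \<phi>) = False"

text \<open>Two-valued tautologies without modality; the choice of \<open>id\<close> to interpret
  the box is immaterial for box-free formulas.\<close>

definition classical_taut :: "mfm \<Rightarrow> bool" where
  "classical_taut \<phi> \<longleftrightarrow> box_free \<phi> \<and> (\<forall>v :: nat \<Rightarrow> bool. meval id v \<phi>)"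

inductive_set Grz :: "mfm set" where
  taut: "classical_taut \<phi> \<Longrightarrow> \<phi> \<in> Grz"
| box_id: "MBox (MImp (MVar 0) (MVar 0)) \<in> Grz"
| box_and: "MImp (MAnd (MBox (MVar 0)) (MBox (MVar 1))) (MBox (MAnd (MVar 0) (MVar 1))) \<in> Grz"
| ax_t: "MImp (MBox (MVar 0)) (MVar 0) \<in> Grz"
| ax_4: "MImp (MBox (MVar 0)) (MBox (MBox (MVar 0))) \<in> Grz"
| ax_grz: "MImp (MBox (MImp (MBox (MImp (MVar 0) (MBox (MVar 0)))) (MVar 0))) (MVar 0) \<in> Grz"
| subst: "\<phi> \<in> Grz \<Longrightarrow> msubst s \<phi> \<in> Grz"
| mp: "\<phi> \<in> Grz \<Longrightarrow> MImp \<phi> \<psi> \<in> Grz \<Longrightarrow> \<psi> \<in> Grz"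
| mono: "MImp \<phi> \<psi> \<in> Grz \<Longrightarrow> MImp (MBox \<phi>) (MBox \<psi>) \<in> Grz"

definition models_Grz :: "('a::boolean_algebra \<Rightarrow> 'a) \<Rightarrow> bool" where
  "models_Grz box \<longleftrightarrow> (\<forall>\<phi>\<in>Grz. \<forall>v. meval box v \<phi> = top)"


section \<open>Formulas with strong negation and validity in twist-structures\<close>

datatype nfm =
    NVar nat
  | NBot
  | NAnd nfm nfm
  | NOr nfm nfm
  | NImp nfm nfm
  | NNeg nfm

datatype bfm =
    BVar nat
  | BBot
  | BAnd bfm bfm
  | BOr bfm bfm
  | BImp bfm bfm
  | BNeg bfm
  | BBox bfm
  | BDia bfm

definition is_hom :: "(nfm \<Rightarrow> 'b) \<Rightarrow> 'b alg \<Rightarrow> bool" where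
  "is_hom v A \<longleftrightarrow>
     (\<forall>\<phi>. v \<phi> \<in> univ A) \<and>
     v NBot = a_bot A \<and>
     (\<forall>\<phi> \<psi>. v (NAnd \<phi> \<psi>) = a_and A (v \<phi>) (v \<psi>)) \<and>
     (\<forall>\<phi> \<psi>. v (NOr \<phi> \<psi>) = a_or A (v \<phi>) (v \<psi>)) \<and>
     (\<forall>\<phi> \<psi>. v (NImp \<phi> \<psi>) = a_imp A (v \<phi>) (v \<psi>)) \<and>
     (\<forall>\<phi>. v (NNeg \<phi>) = a_neg A (v \<phi>))"

definition is_modal_hom :: "(bfm \<Rightarrow> 'b) \<Rightarrow> 'b modal_alg \<Rightarrow> bool" where
  "is_modal_hom v A \<longleftrightarrow>
     (\<forall>\<phi>. v \<phi> \<in> univ A) \<and>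
     v BBot = a_bot A \<and>
     (\<forall>\<phi> \<psi>. v (BAnd \<phi> \<psi>) = a_and A (v \<phi>) (v \<psi>)) \<and>
     (\<forall>\<phi> \<psi>. v (BOr \<phi> \<psi>) = a_or A (v \<phi>) (v \<psi>)) \<and>
     (\<forall>\<phi> \<psi>. v (BImp \<phi> \<psi>) = a_imp A (v \<phi>) (v \<psi>)) \<and>
     (\<forall>\<phi>. v (BNeg \<phi>) = a_neg A (v \<phi>)) \<and>
     (\<forall>\<phi>. v (BBox \<phi>) = a_box A (v \<phi>)) \<and>
     (\<forall>\<phi>. v (BDia \<phi>) = a_dia A (v \<phi>))"

definition valid :: "('a::boolean_algebra \<times> 'a) alg \<Rightarrow> nfm \<Rightarrow> bool" where
  "valid A \<phi> \<longleftrightarrow> (\<forall>v. is_hom v A \<longrightarrow> fst (v \<phi>) = top)"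

definition modal_valid :: "('a::boolean_algebra \<times> 'a) modal_alg \<Rightarrow> bfm \<Rightarrow> bool" where
  "modal_valid A \<phi> \<longleftrightarrow> (\<forall>v. is_modal_hom v A \<longrightarrow> fst (v \<phi>) = top)"

fun trB :: "nfm \<Rightarrow> bfm" where
  "trB (NVar p) = BBox (BVar p)"
| "trB NBot = BBot"
| "trB (NAnd \<phi> \<psi>) = BAnd (trB \<phi>) (trB \<psi>)"
| "trB (NOr \<phi> \<psi>) = BOr (trB \<phi>) (trB \<psi>)"
| "trB (NImp \<phi> \<psi>) = BBox (BImp (trB \<phi>) (trB \<psi>))"
| "trB (NNeg (NVar p)) = BBox (BNeg (BVar p))"
| "trB (NNeg NBot) = BNeg BBot"
| "trB (NNeg (NAnd \<phi> \<psi>)) = BOr (trB (NNeg \<phi>)) (trB (NNeg \<psi>))"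
| "trB (NNeg (NOr \<phi> \<psi>)) = BAnd (trB (NNeg \<phi>)) (trB (NNeg \<psi>))"
| "trB (NNeg (NImp \<phi> \<psi>)) = BAnd (trB \<phi>) (trB (NNeg \<psi>))"
| "trB (NNeg (NNeg \<phi>)) = trB \<phi>"

end

theory Submission
  imports Defs
begin

text \<open>Modulo \<open>F\<close> every open element has an open complement, and with the Grzegorczyk axiom this
  forces the box to be the identity modulo \<open>F\<close>: \<open>a \<rightarrow> \<box>a \<in> F\<close> for all \<open>a\<close>. Consequently
  \<open>(a, b) \<mapsto> (\<box>a, \<box>b)\<close> maps the twist-structure into its open part, and the open part is
  closed under the Heyting implication. So a valuation in either algebra yields one in the other,
  and the value of a formula in the open part is given by the first components of the translations
  of the formula and of its strong negation.\<close>

section \<open>Homomorphisms generated by assignments of the variables\<close>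

primrec nfm_eval :: "'b alg \<Rightarrow> (nat \<Rightarrow> 'b) \<Rightarrow> nfm \<Rightarrow> 'b" where
  "nfm_eval A e (NVar p) = e p"
| "nfm_eval A e NBot = a_bot A"
| "nfm_eval A e (NAnd \<phi> \<psi>) = a_and A (nfm_eval A e \<phi>) (nfm_eval A e \<psi>)"
| "nfm_eval A e (NOr \<phi> \<psi>) = a_or A (nfm_eval A e \<phi>) (nfm_eval A e \<psi>)"
| "nfm_eval A e (NImp \<phi> \<psi>) = a_imp A (nfm_eval A e \<phi>) (nfm_eval A e \<psi>)"
| "nfm_eval A e (NNeg \<phi>) = a_neg A (nfm_eval A e \<phi>)"

primrec bfm_eval :: "'b modal_alg \<Rightarrow> (nat \<Rightarrow> 'b) \<Rightarrow> bfm \<Rightarrow> 'b" where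
  "bfm_eval A e (BVar p) = e p"
| "bfm_eval A e BBot = a_bot A"
| "bfm_eval A e (BAnd \<phi> \<psi>) = a_and A (bfm_eval A e \<phi>) (bfm_eval A e \<psi>)"
| "bfm_eval A e (BOr \<phi> \<psi>) = a_or A (bfm_eval A e \<phi>) (bfm_eval A e \<psi>)"
| "bfm_eval A e (BImp \<phi> \<psi>) = a_imp A (bfm_eval A e \<phi>) (bfm_eval A e \<psi>)"
| "bfm_eval A e (BNeg \<phi>) = a_neg A (bfm_eval A e \<phi>)"
| "bfm_eval A e (BBox \<phi>) = a_box A (bfm_eval A e \<phi>)"
| "bfm_eval A e (BDia \<phi>) = a_dia A (bfm_eval A e \<phi>)"

text \<open>Validity quantifies over homomorphisms defined on all formulas, while the transfer
  between the two algebras only prescribes values of variables. Closure of the universe is what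
  turns such an assignment into a homomorphism.\<close>

lemma is_hom_nfm_eval:
  assumes "\<And>p. e p \<in> univ A"
    and "a_bot A \<in> univ A"
    and "\<And>x y. x \<in> univ A \<Longrightarrow> y \<in> univ A \<Longrightarrow> a_and A x y \<in> univ A"
    and "\<And>x y. x \<in> univ A \<Longrightarrow> y \<in> univ A \<Longrightarrow> a_or A x y \<in> univ A"
    and "\<And>x y. x \<in> univ A \<Longrightarrow> y \<in> univ A \<Longrightarrow> a_imp A x y \<in> univ A"
    and "\<And>x. x \<in> univ A \<Longrightarrow> a_neg A x \<in> univ A"
  shows "is_hom (nfm_eval A e) A"
proof -
  have "nfm_eval A e \<phi> \<in> univ A" for \<phi>
    by (induction \<phi>) (simp_all add: assms)
  then show ?thesis by (simp add: is_hom_def)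
qed

lemma is_modal_hom_bfm_eval:
  assumes "\<And>p. e p \<in> univ A"
    and "a_bot A \<in> univ A"
    and "\<And>x y. x \<in> univ A \<Longrightarrow> y \<in> univ A \<Longrightarrow> a_and A x y \<in> univ A"
    and "\<And>x y. x \<in> univ A \<Longrightarrow> y \<in> univ A \<Longrightarrow> a_or A x y \<in> univ A"
    and "\<And>x y. x \<in> univ A \<Longrightarrow> y \<in> univ A \<Longrightarrow> a_imp A x y \<in> univ A"
    and "\<And>x. x \<in> univ A \<Longrightarrow> a_neg A x \<in> univ A"
    and "\<And>x. x \<in> univ A \<Longrightarrow> a_box A x \<in> univ A"
    and "\<And>x. x \<in> univ A \<Longrightarrow> a_dia A x \<in> univ A"
  shows "is_modal_hom (bfm_eval A e) A"
proof -
  have "bfm_eval A e \<phi> \<in> univ A" for \<phi>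
    by (induction \<phi>) (simp_all add: assms)
  then show ?thesis by (simp add: is_modal_hom_def)
qed

section \<open>Box and diamond in a topological Boolean algebra\<close>

lemma bimp_eq_top_iff: "bimp a b = top \<longleftrightarrow> a \<le> b"
  by (metis bimp_def double_compl shunt1 inf_top_left top.extremum_unique)

lemma (in tba) box_mono: "a \<le> b \<Longrightarrow> box a \<le> box b"
  by (metis box_inf inf.absorb_iff2 inf.commute)

lemma (in tba) box_box: "box (box a) = box a"
  by (simp add: box_le box_le_box_box order.antisym)

lemma (in tba) box_bot: "box bot = bot"
  using box_le[of bot] by (simp add: bot.extremum_unique)

lemma (in tba) box_sup_open: "box a = a \<Longrightarrow> box b = b \<Longrightarrow> box (sup a b) = sup a b"
  by (metis box_le box_mono order.antisym sup.bounded_iff sup_ge1 sup_ge2)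

text \<open>Boxing (a \<or> b) \<and> \<not>b \<le> a and moving \<open>box (- b)\<close> to the
  right. This gives the filter condition for \<open>tw_box\<close>.\<close>

lemma (in tba) box_sup_le: "box (sup a b) \<le> sup (box a) (dia box b)"
proof -
  have "inf (box (sup a b)) (box (- b)) \<le> box a"
    unfolding box_inf[symmetric] by (rule box_mono) (simp add: inf_sup_distrib2)
  then show ?thesis
    by (simp add: dia_def shunt1 sup.commute)
qed

text \<open>Boxing \<not>(a \<and> b) \<and> a \<le> \<not>b, then contraposing. This gives the
  ideal condition for \<open>tw_box\<close>.\<close>

lemma (in tba) inf_dia_le: "inf (box a) (dia box b) \<le> dia box (inf a b)"
proof -
  have "inf (box (- inf a b)) (box a) \<le> box (- b)"
    unfolding box_inf[symmetric] by (rule box_mono) (simp add: inf_sup_distrib2)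
  then have "box (- inf a b) \<le> sup (- box a) (box (- b))"
    by (simp add: shunt1)
  then have "- sup (- box a) (box (- b)) \<le> - box (- inf a b)"
    by (rule compl_mono)
  then show ?thesis by (simp add: dia_def)
qed

section \<open>The Grzegorczyk axiom and the filter\<close>

lemma models_Grz_le:
  assumes "models_Grz box"
  shows "box (bimp (box (bimp a (box a))) a) \<le> a"
proof -
  have "meval box (\<lambda>_. a)
    (MImp (MBox (MImp (MBox (MImp (MVar 0) (MBox (MVar 0)))) (MVar 0))) (MVar 0)) = top"
    using assms Grz.ax_grz unfolding models_Grz_def by blast
  then show ?thesis by (simp add: bimp_eq_top_iff)
qed

locale grz_twist = tba box for box :: "'a::boolean_algebra \<Rightarrow> 'a" +
  fixes F I :: "'a set"
  assumes open_filter: "open_filter box F"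
    and closed_ideal: "closed_ideal box I"
    and models_Grz: "models_Grz box"
    and open_elems_eq_Lam: "open_elems box = Lam box F"
begin

lemma filter_up: "a \<in> F \<Longrightarrow> a \<le> b \<Longrightarrow> b \<in> F"
  using open_filter unfolding open_filter_def lat_filter_def by blast

lemma filter_inf: "a \<in> F \<Longrightarrow> b \<in> F \<Longrightarrow> inf a b \<in> F"
  using open_filter unfolding open_filter_def lat_filter_def by blast

lemma filter_box: "a \<in> F \<Longrightarrow> box a \<in> F"
  using open_filter unfolding open_filter_def by blast

lemma filter_top: "top \<in> F"
  using open_filter filter_up top_greatest unfolding open_filter_def lat_filter_def by blast

lemma ideal_down: "a \<in> I \<Longrightarrow> b \<le> a \<Longrightarrow> b \<in> I"
  using closed_ideal unfolding closed_ideal_def lat_ideal_def by blast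

lemma ideal_sup: "a \<in> I \<Longrightarrow> b \<in> I \<Longrightarrow> sup a b \<in> I"
  using closed_ideal unfolding closed_ideal_def lat_ideal_def by blast

lemma ideal_dia: "a \<in> I \<Longrightarrow> dia box a \<in> I"
  using closed_ideal unfolding closed_ideal_def by blast

lemma ideal_bot: "bot \<in> I"
  using closed_ideal ideal_down bot_least unfolding closed_ideal_def lat_ideal_def by blast

text \<open>The antecedent \<open>q\<close> inside the Grzegorczyk axiom is open, so the hypothesis
  on \<open>Lam\<close> puts q \<or> \<box>\<not>q into \<open>F\<close>. Both joinands lie below a
  \<rightarrow> \<box>a: the first by reflexivity of the box, the second because the axiom bounds it
  by \<box>a.\<close>

lemma bimp_box_in_filter: "bimp a (box a) \<in> F"
proof -
  define q where "q = box (bimp a (box a))"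
  have "q \<in> Lam box F"
    by (simp add: open_elems_eq_Lam[symmetric] open_elems_def q_def box_box)
  then have "sup q (box (- q)) \<in> F" by (simp add: Lam_def)
  \<comment> \<open>The right-hand side is the premise of the Grzegorczyk axiom at
    \<open>a\<close>.\<close>
  moreover have "box (- q) \<le> box (bimp q a)"
    by (rule box_mono) (simp add: bimp_def)
  then have "box (- q) \<le> a"
    using models_Grz_le[OF models_Grz, of a] unfolding q_def by (rule order_trans)
  then have "box (- q) \<le> box a"
    using box_mono box_box by metis
  then have "sup q (box (- q)) \<le> bimp a (box a)"
    using box_le[of "bimp a (box a)"] by (auto simp: q_def bimp_def le_supI2)
  ultimately show ?thesis by (rule filter_up)
qed

text \<open>(a \<or> b) \<and> (a \<rightarrow> \<box>a) \<le> \<box>a \<or> b.\<close>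

lemma sup_box_in_filter: "sup a b \<in> F \<Longrightarrow> sup (box a) b \<in> F"
  by (rule filter_up[OF filter_inf[OF bimp_box_in_filter[of a]]])
     (auto simp: bimp_def inf_sup_distrib1 inf_sup_distrib2 le_infI1 le_infI2 le_supI1 le_supI2)

section \<open>Closure of the twist-structure under its operations\<close>

lemma univ_Tw_iff: "(a, b) \<in> univ (Tw box F I) \<longleftrightarrow> sup a b \<in> F \<and> inf a b \<in> I"
  by (simp add: Tw_def)

lemma Tw_bot: "tw_bot \<in> univ (Tw box F I)"
  by (simp add: tw_bot_def univ_Tw_iff filter_top ideal_bot)

lemma Tw_neg: "x \<in> univ (Tw box F I) \<Longrightarrow> tw_neg x \<in> univ (Tw box F I)"
  by (cases x) (simp add: tw_neg_def univ_Tw_iff sup.commute inf.commute)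

lemma Tw_or:
  assumes "x \<in> univ (Tw box F I)" "y \<in> univ (Tw box F I)"
  shows "tw_or x y \<in> univ (Tw box F I)"
proof -
  obtain a b c d where xy: "x = (a, b)" "y = (c, d)" by fastforce
  have "sup (sup a c) (inf b d) \<in> F"
    by (rule filter_up[OF filter_inf[of "sup a b" "sup c d"]])
       (use assms in \<open>auto simp: xy univ_Tw_iff sup_inf_distrib1 sup_inf_distrib2
          le_infI1 le_infI2 le_supI1 le_supI2\<close>)
  moreover have "inf (sup a c) (inf b d) \<in> I"
    by (rule ideal_down[OF ideal_sup[of "inf a b" "inf c d"]])
       (use assms in \<open>auto simp: xy univ_Tw_iff inf_sup_distrib1 inf_sup_distrib2
          le_infI1 le_infI2 le_supI1 le_supI2\<close>)
  ultimately show ?thesis by (simp add: xy tw_or_def univ_Tw_iff)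
qed

text \<open>De Morgan duality by swapping components, so that closure under meet follows from
  closure under join.\<close>

lemma tw_and_eq: "tw_and x y = tw_neg (tw_or (tw_neg x) (tw_neg y))"
  by (simp add: tw_and_def tw_or_def tw_neg_def split: prod.split)

lemma Tw_and:
  "x \<in> univ (Tw box F I) \<Longrightarrow> y \<in> univ (Tw box F I) \<Longrightarrow> tw_and x y \<in> univ (Tw box F I)"
  by (simp add: tw_and_eq Tw_neg Tw_or)

text \<open>By distributivity the join equals \<not>a \<or> c \<or> d.\<close>

lemma sup_bimp_in_filter: "sup c d \<in> F \<Longrightarrow> sup (bimp a c) (inf a d) \<in> F"
  by (rule filter_up[of "sup c d"])
     (auto simp: bimp_def sup_inf_distrib1 sup_assoc sup_left_commute
       intro: le_supI1 le_supI2)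

lemma inf_bimp_in_ideal: "inf c d \<in> I \<Longrightarrow> inf (bimp a c) (inf a d) \<in> I"
  by (rule ideal_down[of "inf c d"])
     (auto simp: bimp_def inf_sup_distrib2 inf_assoc[symmetric] intro: le_infI1 le_infI2)

lemma Tw_imp:
  "x \<in> univ (Tw box F I) \<Longrightarrow> y \<in> univ (Tw box F I) \<Longrightarrow> tw_imp bimp x y \<in> univ (Tw box F I)"
  by (cases x; cases y)
     (simp add: tw_imp_def univ_Tw_iff sup_bimp_in_filter inf_bimp_in_ideal)

lemma Tw_box:
  assumes "x \<in> univ (Tw box F I)"
  shows "tw_box box x \<in> univ (Tw box F I)"
proof -
  obtain a b where x: "x = (a, b)" by fastforce
  have "sup (box a) (dia box b) \<in> F"
    using assms by (auto simp: x univ_Tw_iff intro: filter_up[OF filter_box box_sup_le])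
  moreover have "inf (box a) (dia box b) \<in> I"
    using assms by (auto simp: x univ_Tw_iff intro: ideal_down[OF ideal_dia inf_dia_le])
  ultimately show ?thesis by (simp add: x tw_box_def univ_Tw_iff)
qed

lemma tw_dia_eq: "tw_dia box x = tw_neg (tw_box box (tw_neg x))"
  by (simp add: tw_dia_def tw_box_def tw_neg_def split: prod.split)

lemma Tw_dia: "x \<in> univ (Tw box F I) \<Longrightarrow> tw_dia box x \<in> univ (Tw box F I)"
  by (simp add: tw_dia_eq Tw_neg Tw_box)

lemma Tw_ops:
  "a_bot (Tw box F I) = tw_bot" "a_and (Tw box F I) = tw_and" "a_or (Tw box F I) = tw_or"
  "a_imp (Tw box F I) = tw_imp bimp" "a_neg (Tw box F I) = tw_neg"
  "a_box (Tw box F I) = tw_box box" "a_dia (Tw box F I) = tw_dia box"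
  by (simp_all add: Tw_def tba_twist_def)

lemma is_modal_hom_Tw:
  "(\<And>p. e p \<in> univ (Tw box F I)) \<Longrightarrow> is_modal_hom (bfm_eval (Tw box F I) e) (Tw box F I)"
  by (rule is_modal_hom_bfm_eval)
     (simp_all add: Tw_ops Tw_bot Tw_neg Tw_and Tw_or Tw_imp Tw_box Tw_dia)

section \<open>The open part and the translation\<close>

lemma G2_ops:
  "a_bot (G2 box T) = tw_bot" "a_and (G2 box T) = tw_and" "a_or (G2 box T) = tw_or"
  "a_imp (G2 box T) = tw_imp (open_imp box)" "a_neg (G2 box T) = tw_neg"
  by (simp_all add: G2_def open_twist_def)

lemma univ_G2_iff:
  "x \<in> univ (G2 box T) \<longleftrightarrow> x \<in> univ T \<and> box (fst x) = fst x \<and> box (snd x) = snd x"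
  by (cases x) (simp add: G2_def)

text \<open>Passing from \<open>bimp\<close> to \<open>open_imp\<close> shrinks the first component.
  This is harmless for the ideal; for the filter, \<open>sup_box_in_filter\<close> restores
  membership.\<close>

lemma Tw_open_imp:
  assumes "x \<in> univ (Tw box F I)" "y \<in> univ (Tw box F I)"
  shows "tw_imp (open_imp box) x y \<in> univ (Tw box F I)"
proof -
  obtain a b c d where xy: "x = (a, b)" "y = (c, d)" by fastforce
  have "inf (box (bimp a c)) (inf a d) \<le> inf (bimp a c) (inf a d)"
    using box_le by (rule inf_mono) simp
  then show ?thesis
    using assms inf_bimp_in_ideal[of c d a]
    by (auto simp: xy tw_imp_def open_imp_def univ_Tw_iff
        intro: sup_box_in_filter sup_bimp_in_filter ideal_down)
qed

lemma is_hom_G2: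
  assumes "\<And>p. e p \<in> univ (G2 box (Tw box F I))"
  shows "is_hom (nfm_eval (G2 box (Tw box F I)) e) (G2 box (Tw box F I))"
proof (rule is_hom_nfm_eval)
  show "e p \<in> univ (G2 box (Tw box F I))" for p by fact
qed (auto simp: univ_G2_iff G2_ops Tw_bot Tw_neg Tw_and Tw_or Tw_open_imp,
     auto simp: tw_bot_def tw_neg_def tw_and_def tw_or_def tw_imp_def open_imp_def
       box_bot box_top box_inf box_box box_sup_open)

lemma box_pair_in_G2:
  assumes "x \<in> univ (Tw box F I)"
  shows "(box (fst x), box (snd x)) \<in> univ (G2 box (Tw box F I))"
proof -
  obtain a b where x: "x = (a, b)" by fastforce
  \<comment> \<open>The components are boxed one after the other.\<close>
  have "sup (box b) (box a) \<in> F"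
    using assms sup_box_in_filter[of a b] sup_box_in_filter[of b "box a"]
    by (simp add: x univ_Tw_iff sup.commute)
  moreover have "inf (box a) (box b) \<in> I"
    using assms by (auto simp: x univ_Tw_iff intro: ideal_down inf_mono box_le)
  ultimately show ?thesis
    by (simp add: x univ_G2_iff univ_Tw_iff box_box sup.commute)
qed

text \<open>In the modal structure the box acts as a diamond on second components, so the second
  component of \<open>w \<phi>\<close> is read off the first component of a translated negation
  instead. Treating both components at once lets a plain structural induction follow
  \<open>trB\<close> through negated compounds.\<close>

lemma hom_eq_trB:
  assumes v: "is_modal_hom v (Tw box F I)" and w: "is_hom w (G2 box (Tw box F I))"
    and var: "\<And>p. w (NVar p) = (box (fst (v (BVar p))), box (snd (v (BVar p))))"
  shows "w \<phi> = (fst (v (trB \<phi>)), fst (v (trB (NNeg \<phi>))))"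
proof -
  note v_simps = v[unfolded is_modal_hom_def Tw_ops]
  note w_simps = w[unfolded is_hom_def G2_ops]
  show ?thesis
    by (induction \<phi>)
       (simp_all add: var v_simps w_simps tw_bot_def tw_neg_def tw_and_def tw_or_def tw_imp_def
         tw_box_def open_imp_def split: prod.split)
qed

lemma valid_G2_iff_modal_valid_trB:
  "valid (G2 box (Tw box F I)) \<phi> \<longleftrightarrow> modal_valid (Tw box F I) (trB \<phi>)"
proof
  assume L: "valid (G2 box (Tw box F I)) \<phi>"
  show "modal_valid (Tw box F I) (trB \<phi>)"
    unfolding modal_valid_def
  proof (intro allI impI)
    fix v assume v: "is_modal_hom v (Tw box F I)"
    define w where "w = nfm_eval (G2 box (Tw box F I))
      (\<lambda>p. (box (fst (v (BVar p))), box (snd (v (BVar p)))))"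
    have w: "is_hom w (G2 box (Tw box F I))"
      unfolding w_def using v by (auto simp: is_modal_hom_def intro!: is_hom_G2 box_pair_in_G2)
    have "w \<phi> = (fst (v (trB \<phi>)), fst (v (trB (NNeg \<phi>))))"
      using v w by (rule hom_eq_trB) (simp add: w_def)
    then show "fst (v (trB \<phi>)) = top"
      using L w by (auto simp: valid_def)
  qed
next
  assume R: "modal_valid (Tw box F I) (trB \<phi>)"
  show "valid (G2 box (Tw box F I)) \<phi>"
    unfolding valid_def
  proof (intro allI impI)
    fix w assume w: "is_hom w (G2 box (Tw box F I))"
    then have univ: "w (NVar p) \<in> univ (G2 box (Tw box F I))" for p
      by (simp add: is_hom_def)
    define v where "v = bfm_eval (Tw box F I) (\<lambda>p. w (NVar p))"
    have v: "is_modal_hom v (Tw box F I)"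
      unfolding v_def using univ by (auto simp: univ_G2_iff intro!: is_modal_hom_Tw)
    have "w \<phi> = (fst (v (trB \<phi>)), fst (v (trB (NNeg \<phi>))))"
      \<comment> \<open>The values of \<open>w\<close> at variables have open components, so the
        boxes required by \<open>var\<close> leave them unchanged.\<close>
      using v w by (rule hom_eq_trB) (use univ in \<open>simp add: v_def univ_G2_iff\<close>)
    then show "fst (w \<phi>) = top"
      using R v by (auto simp: modal_valid_def)
  qed
qed

end

theorem theorem3p2p5:
  fixes box :: "'a::boolean_algebra \<Rightarrow> 'a"
    and F I :: "'a set"
    and T :: "('a \<times> 'a) modal_alg"
    and \<phi> :: nfm
  assumes "tba box"
    and "open_filter box F"
    and "closed_ideal box I"
    and "T = Tw box F I"
    and "models_Grz box"
    and "open_elems box = Lam box F"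
  shows "valid (G2 box T) \<phi> \<longleftrightarrow> modal_valid T (trB \<phi>)"
proof -
  interpret tba box by fact
  interpret grz_twist box F I by unfold_locales fact+
  show ?thesis using assms(4) by (simp add: valid_G2_iff_modal_valid_trB)
qed

end
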